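(* Let $0<\lambda<1$, $0<k<1$ and let $N\ge1$ be an integer. Then $$F(\lambda,k)=K(k)-\frac{(1-\lambda^2)^{1/2}}{(1-k^2)^{1/2}}\sum_{n=0}^{N-1}(1-\lambda^2)^nA_n\!\left(\frac{1-\lambda^2}{1-k^2}\right)+\tilde R_N(\lambda,k),$$ where the remainder $\tilde R_N(\lambda,k)$ (defined by this equality) is negative and satisfies $$\frac{(1-\lambda^2)^{N+1/2}}{2\lambda^2N\sqrt{2-\lambda^2-k^2}}\ge-\tilde R_N(\lambda,k)$$ and $$-\tilde R_N(\lambda,k)\ge\frac{(1-\lambda^2)^{N-1/2}(1/2)_N}{2N\,N!}\left(\sqrt{2-\lambda^2-k^2}-\frac{1-k^2}{2\sqrt{1-\lambda^2}}\ln\left\{1+2\frac{1-\lambda^2}{1-k^2}+2\frac{\sqrt{(1-\lambda^2)(2-\lambda^2-k^2)}}{1-k^2}\right\}\right).$$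
   Context: Legendre's incomplete elliptic integral of the first kind is $F(\lambda,k)=\int_0^\lambda\frac{dt}{\sqrt{(1-t^2)(1-k^2t^2)}}$, and $K(k)=F(1,k)$ is the complete elliptic integral of the first kind. The Pochhammer symbol is $(a)_0=1$, $(a)_n=a(a+1)\cdots(a+n-1)$. For integer $n\ge0$ and $x>0$ the functions $A_n(x)$ are given by any of the following equal expressions: $$A_n(x)=\frac{1}{n!}\frac{d^n}{dx^n}\left[(-1)^n\frac{(1/2)_n}{n!\sqrt x}\ln(\sqrt{1+x}+\sqrt x)+\frac{\sqrt{1+x}}{2nx}\sum_{j=0}^{n-1}(-1)^j\frac{(1/2-n)_j}{(1-n)_j}x^{n-j}\right]$$ (the second term in brackets is zero for $n=0$), $$A_n(x)=\frac{1}{2x^{n+1/2}}\int_0^x\frac{t^{n-1/2}}{\sqrt{1+t}}\,{}_2F_1\!\left(-n,\tfrac12;1;\frac{t}{1+t}\right)dt=\frac{1}{2x^{n+1/2}}\int_0^x\frac{t^{n-1/2}}{(1+t)^{(n+1)/2}}P_n\!\left(\frac{2+t}{2\sqrt{1+t}}\right)dt,$$ where ${}_2F_1$ is the Gauss hypergeometric function and $P_n$ is the Legendre polynomial of degree $n$. *)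

theory Defs
  imports "HOL-Analysis.Analysis"
begin

(* The Henstock-Kurzweil integral covers the integrable endpoint singularities occurring below:
   t = 1 in ellipticF 1 k, and t = 0 in elliptic_A 0 x. *)

definition ellipticF :: "real \<Rightarrow> real \<Rightarrow> real" where
  "ellipticF l k = integral {0..l} (\<lambda>t. 1 / sqrt ((1 - t\<^sup>2) * (1 - k\<^sup>2 * t\<^sup>2)))"

definition ellipticK :: "real \<Rightarrow> real" where
  "ellipticK k = ellipticF 1 k"

definition hypergeo_2F1 :: "real \<Rightarrow> real \<Rightarrow> real \<Rightarrow> real \<Rightarrow> real" where
  "hypergeo_2F1 a b c z =
     (\<Sum>j. pochhammer a j * pochhammer b j / (pochhammer c j * fact j) * z ^ j)"

(* Of the equivalent expressions for A_n(x), x > 0, this takes the integral of the terminating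
   hypergeometric function as the definition. *)
definition elliptic_A :: "nat \<Rightarrow> real \<Rightarrow> real" where
  "elliptic_A n x =
     1 / (2 * x powr (real n + 1/2)) *
     integral {0..x} (\<lambda>t. t powr (real n - 1/2) / sqrt (1 + t) *
       hypergeo_2F1 (- real n) (1/2) 1 (t / (1 + t)))"

definition elliptic_remainder :: "nat \<Rightarrow> real \<Rightarrow> real \<Rightarrow> real" where
  "elliptic_remainder N l k =
     ellipticF l k -
     (ellipticK k - (1 - l\<^sup>2) powr (1/2) / (1 - k\<^sup>2) powr (1/2) *
       (\<Sum>n<N. (1 - l\<^sup>2) ^ n * elliptic_A n ((1 - l\<^sup>2) / (1 - k\<^sup>2))))"

end

theory Submission
  imports Defs
begin

text \<open>
  Put \<open>c = 1 - k\<^sup>2\<close>. The substitution \<open>1 - t\<^sup>2 = c * y\<^sup>2\<close> turns \<open>K(k) - F(l, k)\<close> into the integral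
  over \<open>{0..Y}\<close>, \<open>Y\<^sup>2 = (1 - l\<^sup>2) / c\<close>, of \<open>((1 - w) * (1 - p * w)) powr (-1/2) / sqrt (1 + y\<^sup>2)\<close>
  with \<open>w = c * y\<^sup>2\<close> and \<open>p = 1 / (1 + y\<^sup>2)\<close>. Expanding in powers of \<open>w\<close> gives the coefficients
  \<open>q\<^sub>n(p) = (\<Sum>j\<le>n. b\<^sub>j * b\<^bsub>n-j\<^esub> * p ^ j)\<close> with \<open>b\<^sub>j = (1/2)\<^sub>j / j!\<close>, and a Vandermonde convolution
  identifies \<open>q\<^sub>n(p)\<close> with the hypergeometric polynomial in the definition of \<open>A\<^sub>n\<close>. Hence \<open>- R\<^sub>N\<close> is
  the integral of the tail of this series. Since \<open>b\<^sub>n \<le> q\<^sub>n(p) \<le> q\<^sub>n(1) = 1\<close>, the tail lies between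
  \<open>b\<^sub>N * w ^ N\<close> and \<open>w ^ N / (1 - w)\<close>. The upper bound for \<open>- R\<^sub>N\<close> then uses that \<open>y / sqrt (1 + y\<^sup>2)\<close> is
  increasing, the lower bound Chebyshev's integral inequality.
\<close>

section \<open>Expansion coefficients of the integrand and their hypergeometric form\<close>

definition inv_sqrt_coeff :: "nat \<Rightarrow> real" where
  "inv_sqrt_coeff n = pochhammer (1/2) n / fact n"

text \<open>With \<open>p = 1 / (1 + y\<^sup>2)\<close> this is \<open>p ^ (n/2) * P\<^sub>n ((1 + p) / (2 * sqrt p))\<close>, the
  Legendre polynomial factor in the second integral formula for \<open>A\<^sub>n\<close>.\<close>

definition legendre_conv :: "nat \<Rightarrow> real \<Rightarrow> real" where
  "legendre_conv n p = (\<Sum>j\<le>n. inv_sqrt_coeff j * inv_sqrt_coeff (n - j) * p ^ j)"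

lemma inv_sqrt_coeff_pos: "inv_sqrt_coeff n > 0"
  by (simp add: inv_sqrt_coeff_def pochhammer_pos)

lemma inv_sqrt_coeff_0 [simp]: "inv_sqrt_coeff 0 = 1"
  by (simp add: inv_sqrt_coeff_def)

text \<open>Binomial series with exponent -1/2 at \<open>-w\<close>: the sign of the generalized
  binomial coefficient cancels that of \<open>(-w) ^ n\<close>.\<close>

lemma inv_sqrt_coeff_sums:
  assumes "\<bar>w\<bar> < 1"
  shows "(\<lambda>n. inv_sqrt_coeff n * w ^ n) sums (1 / sqrt (1 - w))"
proof -
  have "((-1/2) gchoose n) * (-w) ^ n = inv_sqrt_coeff n * w ^ n" for n
  proof -
    have "(-w) ^ n = (-1) ^ n * w ^ n"
      by (metis mult_minus1 power_mult_distrib)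
    then show ?thesis
      by (simp add: gbinomial_pochhammer inv_sqrt_coeff_def flip: power_mult_distrib mult.assoc)
  qed
  moreover have "(1 + -w) powr (-1/2) = 1 / sqrt (1 - w)"
    using assms by (simp add: powr_minus_divide powr_half_sqrt)
  ultimately show ?thesis
    using gen_binomial_real[of "-w" "-1/2"] assms by simp
qed

text \<open>Chu-Vandermonde for rising factorials, divided by \<open>fact m\<close>; equivalently,
  the series of (1 - w)^(-a) and (1 - w)^(-b) multiply to that of (1 - w)^(-a-b).\<close>

lemma pochhammer_divide_fact_conv:
  fixes a b :: real
  shows "(\<Sum>j\<le>m. pochhammer a j / fact j * (pochhammer b (m - j) / fact (m - j))) =
    pochhammer (a + b) m / fact m"
proof -
  have "(\<Sum>j\<le>m. pochhammer a j / fact j * (pochhammer b (m - j) / fact (m - j))) =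
      (\<Sum>j\<le>m. of_nat (m choose j) * pochhammer a j * pochhammer b (m - j) / fact m)"
    by (rule sum.cong) (simp_all add: binomial_fact field_simps)
  then show ?thesis
    by (simp add: pochhammer_binomial_sum flip: sum_divide_distrib)
qed

text \<open>The left side is the coefficient of (p - 1)^i when \<open>legendre_conv n p\<close> is
  expanded about p = 1. After shifting j by i, the binomial coefficient times
  \<open>inv_sqrt_coeff (j + i)\<close> splits into \<open>inv_sqrt_coeff i\<close> and
  \<open>pochhammer (1/2 + of_nat i) j / fact j\<close>, so the Vandermonde convolution
  applies.\<close>

lemma binomial_inv_sqrt_coeff_conv:
  assumes "i \<le> n"
  shows "(\<Sum>j\<le>n. of_nat (j choose i) * (inv_sqrt_coeff j * inv_sqrt_coeff (n - j))) =
    inv_sqrt_coeff i * of_nat (n choose i)"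
proof -
  obtain m where n: "n = i + m"
    using assms le_Suc_ex by blast
  have "(\<Sum>j\<le>n. of_nat (j choose i) * (inv_sqrt_coeff j * inv_sqrt_coeff (n - j))) =
      (\<Sum>j\<in>{i..n}. of_nat (j choose i) * (inv_sqrt_coeff j * inv_sqrt_coeff (n - j)))"
    by (rule sum.mono_neutral_right) auto
  also have "\<dots> = (\<Sum>j\<le>m. of_nat ((j + i) choose i) *
      (inv_sqrt_coeff (j + i) * inv_sqrt_coeff (n - (j + i))))"
    using sum.shift_bounds_cl_nat_ivl
      [of "\<lambda>j. of_nat (j choose i) * (inv_sqrt_coeff j * inv_sqrt_coeff (n - j))" 0 i m]
    by (simp add: n add.commute atMost_atLeast0)
  also have "\<dots> = (\<Sum>j\<le>m. inv_sqrt_coeff i *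
      (pochhammer (1/2 + of_nat i) j / fact j * (pochhammer (1/2) (m - j) / fact (m - j))))"
  proof (rule sum.cong)
    fix j
    show "of_nat ((j + i) choose i) * (inv_sqrt_coeff (j + i) * inv_sqrt_coeff (n - (j + i))) =
        inv_sqrt_coeff i *
        (pochhammer (1/2 + of_nat i) j / fact j * (pochhammer (1/2) (m - j) / fact (m - j)))"
      using pochhammer_product'[of "1/2 :: real" i j]
      by (simp add: n inv_sqrt_coeff_def binomial_fact add.commute)
  qed simp
  also have "\<dots> = inv_sqrt_coeff i * (pochhammer (1 + of_nat i) m / fact m)"
    by (simp add: pochhammer_divide_fact_conv sum_distrib_left[symmetric] del: times_divide_eq_right
        times_divide_eq_left divide_divide_eq_left)
  also have "pochhammer (1 + of_nat i) m / fact m = (of_nat (n choose i) :: real)"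
    using pochhammer_product'[of "1::real" i m]
    by (simp add: n binomial_fact field_simps flip: pochhammer_fact)
  finally show ?thesis .
qed

text \<open>Both sides are polynomials in z = 1 - p. Expanding p^j = (1 - z)^j binomially and
  swapping the sums reduces the claim to the convolution identity above, one power of z at a
  time.\<close>

lemma hypergeo_2F1_eq_legendre_conv:
  "hypergeo_2F1 (- real n) (1/2) 1 (1 - p) = legendre_conv n p"
proof -
  define z where "z = 1 - p"
  have "legendre_conv n p =
      (\<Sum>j\<le>n. \<Sum>i\<le>n. (-z) ^ i * (of_nat (j choose i) * (inv_sqrt_coeff j * inv_sqrt_coeff (n - j))))"
    unfolding legendre_conv_def
  proof (rule sum.cong)
    fix j assume j: "j \<in> {..n}"
    have "p ^ j = (\<Sum>i\<le>j. of_nat (j choose i) * (-z) ^ i)"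
      using binomial_ring[of "-z" 1 j] by (simp add: z_def)
    also have "\<dots> = (\<Sum>i\<le>n. of_nat (j choose i) * (-z) ^ i)"
      by (rule sum.mono_neutral_left) (use j in auto)
    finally show "inv_sqrt_coeff j * inv_sqrt_coeff (n - j) * p ^ j =
        (\<Sum>i\<le>n. (-z) ^ i * (of_nat (j choose i) * (inv_sqrt_coeff j * inv_sqrt_coeff (n - j))))"
      by (simp add: sum_distrib_left mult_ac)
  qed simp
  also have "\<dots> = (\<Sum>i\<le>n. (-z) ^ i * (inv_sqrt_coeff i * of_nat (n choose i)))"
    by (subst sum.swap) (simp add: binomial_inv_sqrt_coeff_conv flip: sum_distrib_left)
  also have "\<dots> = hypergeo_2F1 (- real n) (1/2) 1 z"
  proof -
    \<comment> \<open>The binomial coefficient vanishes for j > n, so the hypergeometric series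
      terminates.\<close>
    have *: "pochhammer (- real n) j = (-1) ^ j * fact j * of_nat (n choose j)" for j
      using gbinomial_pochhammer[of "real n" j] 
      by (simp add: binomial_gbinomial flip: power_mult_distrib mult.assoc)
    have "hypergeo_2F1 (- real n) (1/2) 1 z = (\<Sum>j\<le>n. pochhammer (- real n) j *
        pochhammer (1/2) j / (pochhammer 1 j * fact j) * z ^ j)"
      unfolding hypergeo_2F1_def by (rule suminf_finite) (auto simp: * binomial_eq_0)
    also have "\<dots> = (\<Sum>i\<le>n. (-z) ^ i * (inv_sqrt_coeff i * of_nat (n choose i)))"
    proof (rule sum.cong)
      fix j
      have "(-z) ^ j = (-1) ^ j * z ^ j"
        by (metis mult_minus1 power_mult_distrib)
      then show "pochhammer (- real n) j *
        pochhammer (1/2) j / (pochhammer 1 j * fact j) * z ^ j =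
        (-z) ^ j * (inv_sqrt_coeff j * of_nat (n choose j))"
        by (simp add: * inv_sqrt_coeff_def flip: pochhammer_fact)
    qed simp
    finally show ?thesis by simp
  qed
  finally show ?thesis by (simp add: z_def)
qed

lemma legendre_conv_1: "legendre_conv n 1 = 1"
  using pochhammer_divide_fact_conv[of "1/2" "1/2" n]
  by (simp add: legendre_conv_def inv_sqrt_coeff_def flip: pochhammer_fact)

text \<open>The coefficients are nonnegative, so the value at p = 1 dominates on the unit
  interval.\<close>

lemma legendre_conv_le_1:
  assumes "0 \<le> p" "p \<le> 1"
  shows "legendre_conv n p \<le> 1"
proof -
  have "legendre_conv n p \<le> legendre_conv n 1"
    unfolding legendre_conv_def
    by (rule sum_mono, rule mult_left_mono)
       (use assms in \<open>auto simp: power_le_one less_imp_le[OF inv_sqrt_coeff_pos]\<close>)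
  then show ?thesis by (simp add: legendre_conv_1)
qed

lemma legendre_conv_ge:
  assumes "0 \<le> p"
  shows "inv_sqrt_coeff n \<le> legendre_conv n p"
proof -
  have "(\<Sum>j\<in>{0}. inv_sqrt_coeff j * inv_sqrt_coeff (n - j) * p ^ j) \<le> legendre_conv n p"
    unfolding legendre_conv_def
    by (rule sum_mono2) (use assms in \<open>auto simp: less_imp_le[OF inv_sqrt_coeff_pos]\<close>)
  then show ?thesis by simp
qed

text \<open>Cauchy product of the binomial series for 1/sqrt(1 - pw) and 1/sqrt(1 - w).\<close>

lemma legendre_conv_sums:
  assumes "0 \<le> p" "p \<le> 1" "0 \<le> w" "w < 1"
  shows "(\<lambda>n. w ^ n * legendre_conv n p) sums (1 / sqrt ((1 - w) * (1 - p * w)))"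
proof -
  have pw: "p * w < 1" "0 \<le> p * w"
    using assms mult_left_le_one_le[of w p] by auto
  have s1: "(\<lambda>n. inv_sqrt_coeff n * (p * w) ^ n) sums (1 / sqrt (1 - p * w))"
    using pw by (intro inv_sqrt_coeff_sums) auto
  have s2: "(\<lambda>n. inv_sqrt_coeff n * w ^ n) sums (1 / sqrt (1 - w))"
    using assms by (intro inv_sqrt_coeff_sums) auto
  have "(\<lambda>n. \<Sum>i\<le>n. (inv_sqrt_coeff i * (p * w) ^ i) * (inv_sqrt_coeff (n - i) * w ^ (n - i)))
      sums ((\<Sum>n. inv_sqrt_coeff n * (p * w) ^ n) * (\<Sum>n. inv_sqrt_coeff n * w ^ n))"
    using sums_summable[OF s1] sums_summable[OF s2] pw assms
    by (intro Cauchy_product_sums) (auto simp: abs_mult less_imp_le[OF inv_sqrt_coeff_pos])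
  moreover have "(\<Sum>i\<le>n. (inv_sqrt_coeff i * (p * w) ^ i) * (inv_sqrt_coeff (n - i) * w ^ (n - i)))
      = w ^ n * legendre_conv n p" for n
    unfolding legendre_conv_def sum_distrib_left
  proof (rule sum.cong)
    fix i assume "i \<in> {..n}"
    then have "w ^ n = w ^ i * w ^ (n - i)"
      by (simp flip: power_add)
    then show "(inv_sqrt_coeff i * (p * w) ^ i) * (inv_sqrt_coeff (n - i) * w ^ (n - i)) =
        w ^ n * (inv_sqrt_coeff i * inv_sqrt_coeff (n - i) * p ^ i)"
      by (simp add: power_mult_distrib)
  qed simp
  moreover have "(\<Sum>n. inv_sqrt_coeff n * (p * w) ^ n) * (\<Sum>n. inv_sqrt_coeff n * w ^ n) =
      1 / sqrt ((1 - w) * (1 - p * w))"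
    unfolding sums_unique[OF s1, symmetric] sums_unique[OF s2, symmetric]
    by (simp add: real_sqrt_mult)
  ultimately show ?thesis
    by simp
qed

text \<open>All terms of the tail are nonnegative. Keeping only the first gives the lower bound;
  replacing each \<open>legendre_conv\<close> by 1 leaves a geometric series, which gives the upper
  bound.\<close>

lemma legendre_conv_tail_bounds:
  fixes N :: nat
  assumes "0 \<le> p" "p \<le> 1" "0 \<le> w" "w < 1"
  defines "T \<equiv> 1 / sqrt ((1 - w) * (1 - p * w)) - (\<Sum>n<N. w ^ n * legendre_conv n p)"
  shows "w ^ N * inv_sqrt_coeff N \<le> T" and "T \<le> w ^ N / (1 - w)"
proof -
  have nn: "0 \<le> legendre_conv n p" for n
    using legendre_conv_ge[OF assms(1), of n] inv_sqrt_coeff_pos[of n] by linarith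
  have T: "(\<lambda>n. w ^ (n + N) * legendre_conv (n + N) p) sums T"
    using legendre_conv_sums[OF assms(1-4)] unfolding T_def
    by (subst sums_iff_shift) simp
  have "w ^ N * inv_sqrt_coeff N \<le> w ^ N * legendre_conv N p"
    using assms legendre_conv_ge by (intro mult_left_mono) auto
  also have "\<dots> = (\<Sum>n\<in>{0}. w ^ (n + N) * legendre_conv (n + N) p)"
    by simp
  also have "\<dots> \<le> T"
    unfolding sums_unique[OF T]
    by (rule sum_le_suminf[OF sums_summable[OF T]]) (use assms nn in auto)
  finally show "w ^ N * inv_sqrt_coeff N \<le> T" .
  have "(\<lambda>n. w ^ N * w ^ n) sums (w ^ N * (1 / (1 - w)))"
    using assms by (intro sums_mult geometric_sums) auto
  with T have "T \<le> w ^ N * (1 / (1 - w))"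
    by (rule sums_le[rotated])
       (use assms legendre_conv_le_1[OF assms(1,2)] in
         \<open>auto simp flip: power_add simp: add.commute intro!: mult_left_le\<close>)
  then show "T \<le> w ^ N / (1 - w)" by simp
qed

section \<open>Substitution in the singular integrals\<close>

text \<open>Differentiability of \<open>g\<close> is required only in the open interval because the
  square roots substituted below have no finite derivative at one endpoint. Measuring both integrals
  of \<open>h\<close> from \<open>c\<close> lets the same formula serve a decreasing
  \<open>g\<close>.\<close>

lemma has_integral_substitution_interior:
  fixes g h :: "real \<Rightarrow> real"
  assumes "a \<le> b" and h: "continuous_on {c..d} h" and g: "continuous_on {a..b} g"
    and gcd: "g ` {a..b} \<subseteq> {c..d}" and gint: "g ` {a<..<b} \<subseteq> {c<..<d}"
    and g': "\<And>x. a < x \<Longrightarrow> x < b \<Longrightarrow> (g has_real_derivative g' x) (at x)"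
  shows "((\<lambda>x. g' x * h (g x)) has_integral (integral {c..g b} h - integral {c..g a} h)) {a..b}"
proof (rule fundamental_theorem_of_calculus_interior[OF \<open>a \<le> b\<close>])
  show "continuous_on {a..b} (\<lambda>x. integral {c..g x} h)"
    by (rule continuous_on_compose2[OF indefinite_integral_continuous_1 g gcd])
       (intro integrable_continuous_interval h)
next
  fix x assume x: "x \<in> {a<..<b}"
  then have gx: "g x \<in> {c<..<d}"
    using gint by blast
  have "((\<lambda>y. integral {c..y} h) has_real_derivative h (g x)) (at (g x))"
    using integral_has_real_derivative[OF h, of "g x"] gx
    by (simp add: at_within_Icc_at)
  then have "((\<lambda>x. integral {c..g x} h) has_real_derivative h (g x) * g' x) (at x)"
    using DERIV_chain2 g' x by fastforce
  then show "((\<lambda>x. integral {c..g x} h) has_vector_derivative g' x * h (g x)) (at x)"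
    by (simp add: has_real_derivative_iff_has_vector_derivative mult.commute)
qed

text \<open>Substitute t = y^2, which removes the singularity at t = 0, and use t/(1 + t) = 1 - 1/(1
  + t) to reach \<open>legendre_conv\<close>.\<close>

lemma elliptic_A_eq_integral:
  assumes "x > 0"
  shows "elliptic_A n x = 1 / (x ^ n * sqrt x) *
    integral {0..sqrt x} (\<lambda>y. y ^ (2 * n) / sqrt (1 + y\<^sup>2) * legendre_conv n (1 / (1 + y\<^sup>2)))"
    (is "_ = _ * integral _ ?h")
proof -
  have h: "continuous_on {0..sqrt x} ?h"
    unfolding legendre_conv_def
    by (intro continuous_intros) (auto simp: add_pos_nonneg add_nonneg_eq_0_iff)
  have "((\<lambda>t. 1 / (2 * sqrt t) * ?h (sqrt t)) has_integral
      (integral {0..sqrt x} ?h - integral {0..sqrt 0} ?h)) {0..x}"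
    by (rule has_integral_substitution_interior[OF _ h])
       (use assms in \<open>auto intro!: derivative_eq_intros continuous_intros simp: field_simps\<close>)
  then have "((\<lambda>t. 1 / (2 * sqrt t) * ?h (sqrt t)) has_integral integral {0..sqrt x} ?h) {0..x}"
    by simp
  then have "((\<lambda>t. 2 * (1 / (2 * sqrt t) * ?h (sqrt t))) has_integral 2 * integral {0..sqrt x} ?h) {0..x}"
    by (rule has_integral_mult_right)
  \<comment> \<open>The identity survives at t = 0: there both sides are 0, by
    \<open>0 powr a = 0\<close> and division by zero.\<close>
  moreover have "t powr (real n - 1/2) / sqrt (1 + t) *
       hypergeo_2F1 (- real n) (1/2) 1 (t / (1 + t)) = 2 * (1 / (2 * sqrt t) * ?h (sqrt t))"
    if "t \<in> {0..x}" for t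
  proof (cases "t = 0")
    case False
    with that have t: "t > 0" by simp
    have "t / (1 + t) = 1 - 1 / (1 + t)"
      using t by (simp add: field_simps)
    moreover have "t powr (real n - 1/2) = t ^ n / sqrt t"
      using t by (simp add: powr_diff powr_realpow powr_half_sqrt)
    ultimately show ?thesis
      using t by (simp add: hypergeo_2F1_eq_legendre_conv power_mult)
  qed simp
  ultimately have "((\<lambda>t. t powr (real n - 1/2) / sqrt (1 + t) *
       hypergeo_2F1 (- real n) (1/2) 1 (t / (1 + t))) has_integral 2 * integral {0..sqrt x} ?h) {0..x}"
    by (subst has_integral_cong)
  then have "integral {0..x} (\<lambda>t. t powr (real n - 1/2) / sqrt (1 + t) *
       hypergeo_2F1 (- real n) (1/2) 1 (t / (1 + t))) = 2 * integral {0..sqrt x} ?h"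
    by (rule integral_unique)
  moreover have "x powr (real n + 1/2) = x ^ n * sqrt x"
    using assms by (simp add: powr_add powr_realpow powr_half_sqrt)
  ultimately show ?thesis
    by (simp add: elliptic_A_def)
qed

lemma denominators_pos:
  fixes l c y :: real
  assumes "0 < l" "l < 1" "0 < c" "y \<in> {0..sqrt ((1 - l\<^sup>2) / c)}"
  shows "c * y\<^sup>2 \<le> 1 - l\<^sup>2" "1 - c * y\<^sup>2 > 0" "1 + y\<^sup>2 - c * y\<^sup>2 > 0"
proof -
  have "y\<^sup>2 \<le> (sqrt ((1 - l\<^sup>2) / c))\<^sup>2"
    using assms by (intro power_mono) auto
  also have "\<dots> = (1 - l\<^sup>2) / c"
    using assms by (intro real_sqrt_pow2) (simp add: abs_square_le_1)
  finally show "c * y\<^sup>2 \<le> 1 - l\<^sup>2"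
    using assms by (simp add: field_simps)
  then show "1 - c * y\<^sup>2 > 0"
    using assms zero_less_power[of l 2] by linarith
  then show "1 + y\<^sup>2 - c * y\<^sup>2 > 0"
    using zero_le_power2[of y] by linarith
qed

text \<open>The map \<open>g\<close> below decreases from \<open>Y\<close> at \<open>l\<close> to 0
  at 1, hence the sign change. Its derivative absorbs the singularity at t = 1, so the new integrand
  is continuous on the closed interval.\<close>

lemma elliptic_integrand_has_integral:
  assumes "0 < l" "l < 1" "0 \<le> k" "k < 1"
  defines "c \<equiv> 1 - k\<^sup>2"
  defines "Y \<equiv> sqrt ((1 - l\<^sup>2) / c)"
  shows "((\<lambda>t. 1 / sqrt ((1 - t\<^sup>2) * (1 - k\<^sup>2 * t\<^sup>2))) has_integral
    integral {0..Y} (\<lambda>y. 1 / sqrt ((1 - c * y\<^sup>2) * (1 + y\<^sup>2 - c * y\<^sup>2)))) {l..1}"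
    (is "(?f has_integral integral _ ?h) _")
proof -
  have c: "0 < c" "c \<le> 1"
    using assms by (auto simp: c_def abs_square_less_1)
  have pos: "1 - c * y\<^sup>2 > 0" "1 + y\<^sup>2 - c * y\<^sup>2 > 0" if "y \<in> {0..Y}" for y
    using denominators_pos[OF assms(1,2) c(1)] that unfolding Y_def by auto
  have h: "continuous_on {0..Y} ?h"
    by (intro continuous_intros) (use pos in fastforce)
  define g where "g = (\<lambda>t. sqrt ((1 - t\<^sup>2) / c))"
  have sq: "0 < 1 - t\<^sup>2" "t\<^sup>2 > l\<^sup>2" if "l < t" "t < 1" for t
    using that assms by (auto simp: abs_square_less_1 intro!: power_strict_mono)
  have sq': "0 \<le> 1 - t\<^sup>2" "t\<^sup>2 \<ge> l\<^sup>2" if "l \<le> t" "t \<le> 1" for t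
    using that assms by (auto simp: abs_square_le_1 intro!: power_mono)
  have "((\<lambda>t. (- t / (c * g t)) * ?h (g t)) has_integral
      (integral {0..g 1} ?h - integral {0..g l} ?h)) {l..1}"
  proof (rule has_integral_substitution_interior[OF _ h])
    show "continuous_on {l..1} g"
      unfolding g_def using c by (intro continuous_intros) auto
    show "g ` {l..1} \<subseteq> {0..Y}"
      unfolding g_def Y_def using c sq' by (auto intro!: divide_right_mono)
    show "g ` {l<..<1} \<subseteq> {0<..<Y}"
      unfolding g_def Y_def using c sq by (auto intro!: divide_strict_right_mono)
    show "(g has_real_derivative - t / (c * g t)) (at t)" if "l < t" "t < 1" for t
      unfolding g_def using c sq[OF that]
      by (auto intro!: derivative_eq_intros simp: field_simps)
  qed (use assms in simp)
  moreover have "integral {0..g 1} ?h - integral {0..g l} ?h = - integral {0..Y} ?h"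
    by (simp add: g_def Y_def)
  ultimately have "((\<lambda>t. (- t / (c * g t)) * ?h (g t)) has_integral - integral {0..Y} ?h) {l..1}"
    by (simp only:)
  from has_integral_neg[OF this]
  have "((\<lambda>t. - ((- t / (c * g t)) * ?h (g t))) has_integral integral {0..Y} ?h) {l..1}"
    by (simp only: minus_minus)
  \<comment> \<open>At t = 1 both sides are quotients by zero and thus equal to 0.\<close>
  moreover have "?f t = - ((- t / (c * g t)) * ?h (g t))" if "t \<in> {l..1}" for t
  proof -
    have t: "0 \<le> 1 - t\<^sup>2" "t > 0"
      using that sq' assms by auto
    have g2: "(g t)\<^sup>2 = (1 - t\<^sup>2) / c"
      unfolding g_def using c t by (intro real_sqrt_pow2) auto
    have "1 - c * (g t)\<^sup>2 = t\<^sup>2"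
      using c by (simp add: g2)
    moreover have "1 + (g t)\<^sup>2 - c * (g t)\<^sup>2 = (1 - k\<^sup>2 * t\<^sup>2) / c"
      using c by (simp add: g2 field_simps) (simp add: c_def algebra_simps)
    ultimately have "?h (g t) = sqrt c / (t * sqrt (1 - k\<^sup>2 * t\<^sup>2))"
      using t by (simp add: real_sqrt_mult real_sqrt_divide)
    moreover have "c * g t = sqrt c * sqrt (1 - t\<^sup>2)"
      using c by (simp add: g_def real_sqrt_divide real_div_sqrt field_simps)
    ultimately show ?thesis
      using t c by (simp add: real_sqrt_mult)
  qed
  ultimately show ?thesis
    by (subst has_integral_cong)
qed

lemma ellipticK_minus_ellipticF:
  assumes "0 < l" "l < 1" "0 \<le> k" "k < 1"
  shows "ellipticK k - ellipticF l k =
    integral {0..sqrt ((1 - l\<^sup>2) / (1 - k\<^sup>2))}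
      (\<lambda>y. 1 / sqrt ((1 - (1 - k\<^sup>2) * y\<^sup>2) * (1 + y\<^sup>2 - (1 - k\<^sup>2) * y\<^sup>2)))"
proof -
  let ?f = "\<lambda>t. 1 / sqrt ((1 - t\<^sup>2) * (1 - k\<^sup>2 * t\<^sup>2))"
  note I = elliptic_integrand_has_integral[OF assms]
  have "?f integrable_on {0..l}"
  proof (intro integrable_continuous_interval continuous_intros ballI)
    fix t assume "t \<in> {0..l}"
    then have "t\<^sup>2 < 1" "k\<^sup>2 \<le> 1"
      using assms by (auto simp: abs_square_less_1 abs_square_le_1)
    moreover from this have "k\<^sup>2 * t\<^sup>2 < 1"
      using mult_left_le_one_le[of "t\<^sup>2" "k\<^sup>2"] by simp
    ultimately show "sqrt ((1 - t\<^sup>2) * (1 - k\<^sup>2 * t\<^sup>2)) \<noteq> 0" by simp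
  qed
  then have "(?f has_integral (ellipticF l k + integral {l..1} ?f)) {0..1}"
    unfolding ellipticF_def
    by (intro has_integral_combine[of 0 l 1] integrable_integral)
       (use assms I in \<open>auto simp: has_integral_integrable_integral\<close>)
  then show ?thesis
    using integral_unique[OF I] by (simp add: ellipticK_def ellipticF_def integral_unique)
qed

section \<open>The remainder as an integral of the series tail\<close>

text \<open>Only the finite partial sum is integrated termwise, so no limit has to be interchanged
  with the integral. With \<open>x = (1 - l\<^sup>2) / c\<close>, each term yields c^n x^n sqrt(x)
  A_n(x), where c x = 1 - l^2 and sqrt(x) is the prefactor in the remainder.\<close>

lemma neg_elliptic_remainder_has_integral:
  assumes "0 < l" "l < 1" "0 \<le> k" "k < 1"
  defines "c \<equiv> 1 - k\<^sup>2"
  defines "Y \<equiv> sqrt ((1 - l\<^sup>2) / c)"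
  shows "((\<lambda>y. (1 / sqrt ((1 - c * y\<^sup>2) * (1 - 1 / (1 + y\<^sup>2) * (c * y\<^sup>2))) -
      (\<Sum>n<N. (c * y\<^sup>2) ^ n * legendre_conv n (1 / (1 + y\<^sup>2)))) / sqrt (1 + y\<^sup>2)) has_integral
    - elliptic_remainder N l k) {0..Y}"
proof -
  have c: "0 < c" "c \<le> 1" and m: "0 < 1 - l\<^sup>2"
    using assms by (auto simp: c_def abs_square_less_1)
  define x where "x = (1 - l\<^sup>2) / c"
  have x: "x > 0" and cx: "c * x = 1 - l\<^sup>2"
    using c m by (simp_all add: x_def)
  let ?h = "\<lambda>y. 1 / sqrt ((1 - c * y\<^sup>2) * (1 + y\<^sup>2 - c * y\<^sup>2))"
  let ?a = "\<lambda>n y. y ^ (2 * n) / sqrt (1 + y\<^sup>2) * legendre_conv n (1 / (1 + y\<^sup>2))"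
  have y2: "1 + y\<^sup>2 > 0" "1 + y\<^sup>2 \<noteq> 0" for y :: real
    by (auto simp: add_pos_nonneg add_nonneg_eq_0_iff)
  have pos: "1 - c * y\<^sup>2 > 0" "1 + y\<^sup>2 - c * y\<^sup>2 > 0" if "y \<in> {0..Y}" for y
    using denominators_pos[OF assms(1,2) c(1)] that unfolding Y_def by auto
  have "continuous_on {0..Y} ?h"
    by (intro continuous_intros) (use pos in fastforce)
  then have h: "(?h has_integral (ellipticK k - ellipticF l k)) {0..Y}"
    using ellipticK_minus_ellipticF[OF assms(1-4)]
    by (simp add: c_def Y_def integrable_continuous_interval integrable_integral)
  have "continuous_on {0..Y} (?a n)" for n
    unfolding legendre_conv_def
    by (intro continuous_intros) (use y2 in auto)
  then have "(?a n has_integral integral {0..Y} (?a n)) {0..Y}" for n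
    by (intro integrable_integral integrable_continuous_interval)
  moreover have "integral {0..Y} (?a n) = x ^ n * sqrt x * elliptic_A n x" for n
    using elliptic_A_eq_integral[OF x, of n] x by (simp add: x_def Y_def)
  ultimately have "((\<lambda>y. \<Sum>n<N. c ^ n * ?a n y) has_integral
      (\<Sum>n<N. c ^ n * (x ^ n * sqrt x * elliptic_A n x))) {0..Y}"
    by (intro has_integral_sum has_integral_mult_right) auto
  with h have "((\<lambda>y. ?h y - (\<Sum>n<N. c ^ n * ?a n y)) has_integral (ellipticK k - ellipticF l k -
      (\<Sum>n<N. c ^ n * (x ^ n * sqrt x * elliptic_A n x)))) {0..Y}"
    by (rule has_integral_diff)
  moreover have "ellipticK k - ellipticF l k -
      (\<Sum>n<N. c ^ n * (x ^ n * sqrt x * elliptic_A n x)) = - elliptic_remainder N l k"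
  proof -
    have "(1 - l\<^sup>2) powr (1/2) / (1 - k\<^sup>2) powr (1/2) = sqrt x"
      using c m by (simp add: x_def powr_half_sqrt real_sqrt_divide flip: c_def)
    moreover have eq: "c ^ n * (x ^ n * sqrt x * elliptic_A n x) =
        sqrt x * ((1 - l\<^sup>2) ^ n * elliptic_A n x)" for n
      by (simp flip: cx add: power_mult_distrib)
    ultimately show ?thesis
      unfolding elliptic_remainder_def c_def[symmetric] x_def[symmetric]
      by (simp only: eq flip: sum_distrib_left)
  qed
  moreover have "?h y - (\<Sum>n<N. c ^ n * ?a n y) =
    (1 / sqrt ((1 - c * y\<^sup>2) * (1 - 1 / (1 + y\<^sup>2) * (c * y\<^sup>2))) -
      (\<Sum>n<N. (c * y\<^sup>2) ^ n * legendre_conv n (1 / (1 + y\<^sup>2)))) / sqrt (1 + y\<^sup>2)" for y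
  proof -
    \<comment> \<open>Pulling 1 + y^2 out of the second factor produces 1 - pw with p = 1/(1 + y^2)
      and w = c y^2.\<close>
    have "(1 - c * y\<^sup>2) * (1 + y\<^sup>2 - c * y\<^sup>2) =
        ((1 - c * y\<^sup>2) * (1 - 1 / (1 + y\<^sup>2) * (c * y\<^sup>2))) * (1 + y\<^sup>2)"
      using y2(2)[of y] by (simp add: field_simps)
    then have "?h y = 1 / sqrt ((1 - c * y\<^sup>2) * (1 - 1 / (1 + y\<^sup>2) * (c * y\<^sup>2))) / sqrt (1 + y\<^sup>2)"
      by (simp only: real_sqrt_mult divide_divide_eq_left)
    then show ?thesis
      by (simp add: diff_divide_distrib sum_divide_distrib power_mult_distrib mult_ac flip: power_mult)
  qed
  ultimately show ?thesis
    by simp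
qed

section \<open>Elementary integrals and inequalities for arsinh\<close>

lemma has_integral_power_0:
  fixes Y :: real
  assumes "0 \<le> Y"
  shows "((\<lambda>y. y ^ n) has_integral Y ^ Suc n / real (Suc n)) {0..Y}"
proof -
  have "((\<lambda>y. y ^ Suc n / real (Suc n)) has_real_derivative y ^ n) (at y within {0..Y})" for y
    using DERIV_cdivide[OF DERIV_pow[of "Suc n" y], of "real (Suc n)"] by (simp del: power_Suc)
  then have "((\<lambda>y. y ^ n) has_integral (Y ^ Suc n / real (Suc n) - 0 ^ Suc n / real (Suc n))) {0..Y}"
    using assms
    by (intro fundamental_theorem_of_calculus)
       (simp_all only: has_real_derivative_iff_has_vector_derivative)
  then show ?thesis by simp
qed

lemma has_derivative_sqrt_one_plus_square:
  fixes t :: real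
  shows "((\<lambda>t. sqrt (1 + t\<^sup>2)) has_real_derivative t / sqrt (1 + t\<^sup>2)) (at t)"
proof -
  have "1 + t\<^sup>2 > 0" by (simp add: add_pos_nonneg)
  then show ?thesis
    by (auto intro!: derivative_eq_intros simp: divide_simps)
qed

text \<open>The difference of the two sides vanishes at 0 and has derivative t^2/(1 +
  t^2)^(3/2).\<close>

lemma arsinh_ge:
  fixes y :: real
  assumes "0 \<le> y"
  shows "y / sqrt (1 + y\<^sup>2) \<le> arsinh y"
proof -
  have "((\<lambda>t. arsinh t - t / sqrt (1 + t\<^sup>2)) has_real_derivative
      t\<^sup>2 / (1 + t\<^sup>2) / sqrt (1 + t\<^sup>2)) (at t)" for t :: real
  proof -
    define s where "s = sqrt (1 + t\<^sup>2)"
    have p: "1 + t\<^sup>2 > 0" by (simp add: add_pos_nonneg)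
    then have s: "s > 0" and ss: "1 + t\<^sup>2 = s * s" by (simp_all add: s_def)
    have "((\<lambda>t. arsinh t - t / sqrt (1 + t\<^sup>2)) has_real_derivative
        1 / sqrt (t\<^sup>2 + 1) - (1 * s - t * (t / s)) / (s * s)) (at t)"
      using s unfolding s_def
      by (intro DERIV_diff DERIV_divide arsinh_real_has_field_derivative DERIV_ident
            has_derivative_sqrt_one_plus_square) simp
    moreover have "1 / sqrt (t\<^sup>2 + 1) - (1 * s - t * (t / s)) / (s * s) = t\<^sup>2 / (1 + t\<^sup>2) / s"
    proof -
      have "sqrt (t\<^sup>2 + 1) = s" by (simp add: s_def add.commute)
      then show ?thesis
        unfolding ss using s by (simp add: divide_simps power2_eq_square)
    qed
    ultimately show ?thesis by (simp add: s_def)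
  qed
  then have "arsinh 0 - 0 / sqrt (1 + 0\<^sup>2) \<le> arsinh y - y / sqrt (1 + y\<^sup>2)"
    by (intro DERIV_nonneg_imp_nondecreasing[OF assms]) (fastforce simp: add_nonneg_nonneg)
  then show ?thesis by simp
qed

text \<open>Supplies the closed form of the integral behind the logarithm in the lower
  bound.\<close>

lemma has_derivative_mult_sqrt_minus_arsinh:
  fixes t :: real
  shows "((\<lambda>y. y * sqrt (1 + y\<^sup>2) - arsinh y) has_real_derivative 2 * t\<^sup>2 / sqrt (1 + t\<^sup>2)) (at t)"
proof -
  define s where "s = sqrt (1 + t\<^sup>2)"
  have "1 + t\<^sup>2 > 0" by (simp add: add_pos_nonneg)
  then have s: "s > 0" and ss: "s * s = 1 + t\<^sup>2" by (simp_all add: s_def)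
  have "((\<lambda>y. y * sqrt (1 + y\<^sup>2) - arsinh y) has_real_derivative
      (1 * s + (t / s) * t) - 1 / sqrt (t\<^sup>2 + 1)) (at t)"
    unfolding s_def
    by (intro DERIV_diff DERIV_mult arsinh_real_has_field_derivative DERIV_ident
          has_derivative_sqrt_one_plus_square)
  moreover have "(1 * s + (t / s) * t) - 1 / sqrt (t\<^sup>2 + 1) = 2 * t\<^sup>2 / s"
  proof -
    have "sqrt (t\<^sup>2 + 1) = s" by (simp add: s_def add.commute)
    then show ?thesis
      using s ss by (simp add: divide_simps) (simp add: power2_eq_square)
  qed
  ultimately show ?thesis by (simp add: s_def)
qed

lemma arsinh_less:
  fixes y :: real
  assumes "0 < y"
  shows "arsinh y < y * sqrt (1 + y\<^sup>2)"
proof -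
  let ?E = "\<lambda>y::real. y * sqrt (1 + y\<^sup>2) - arsinh y"
  note D = has_derivative_mult_sqrt_minus_arsinh
  have "?E 0 < ?E y"
  proof (rule DERIV_pos_imp_increasing_open[OF assms])
    fix x :: real assume "0 < x" "x < y"
    then have "0 < 2 * x\<^sup>2 / sqrt (1 + x\<^sup>2)"
      by (simp add: add_pos_nonneg)
    with D show "\<exists>d. (?E has_real_derivative d) (at x) \<and> 0 < d"
      by blast
  next
    show "continuous_on {0..y} ?E"
      using D by (intro continuous_at_imp_continuous_on ballI) (rule DERIV_isCont)
  qed
  then show ?thesis by simp
qed

text \<open>Chebyshev's integral inequality for the increasing functions \<open>s ^ (N - 1)\<close> and
  \<open>sqrt (s / (1 + s))\<close> of \<open>s = y\<^sup>2\<close>; the bracket is \<open>\<integral> sqrt (s / (1 + s)) ds\<close> over \<open>{0..Y\<^sup>2}\<close>.\<close>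

lemma integral_even_power_div_sqrt_ge:
  fixes Y I :: real
  assumes "0 \<le> Y" "N \<ge> 1"
    and I: "((\<lambda>y. y ^ (2 * N) / sqrt (1 + y\<^sup>2)) has_integral I) {0..Y}"
  shows "Y ^ (2 * N - 2) / (2 * real N) * (Y * sqrt (1 + Y\<^sup>2) - arsinh Y) \<le> I"
proof -
  obtain M where N: "N = Suc M"
    using assms(2) by (cases N) auto
  define E where "E = (\<lambda>y::real. y * sqrt (1 + y\<^sup>2) - arsinh y)"
  have p: "1 + t\<^sup>2 > 0" "sqrt (1 + t\<^sup>2) * sqrt (1 + t\<^sup>2) = 1 + t\<^sup>2" "sqrt (1 + t\<^sup>2) > 0" for t :: real
    by (simp_all add: add_pos_nonneg)
  have E': "(E has_real_derivative 2 * t\<^sup>2 / sqrt (1 + t\<^sup>2)) (at t)" for t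
    unfolding E_def by (rule has_derivative_mult_sqrt_minus_arsinh)
  \<comment> \<open>By s = y^2, the quotient E(t)/t^2 is the mean of the increasing function
    sqrt(s/(1 + s)) over 0..t^2, hence at most its endpoint value t/sqrt(1 + t^2).\<close>
  have E_le: "E t \<le> t ^ 3 / sqrt (1 + t\<^sup>2)" if "0 \<le> t" for t
  proof -
    have "t * sqrt (1 + t\<^sup>2) = t ^ 3 / sqrt (1 + t\<^sup>2) + t / sqrt (1 + t\<^sup>2)"
      using p[of t] by (simp add: field_simps power2_eq_square power3_eq_cube)
    then show ?thesis
      using arsinh_ge[OF that] by (simp add: E_def)
  qed
  \<comment> \<open>\<open>D\<close> is the derivative of the claimed lower bound as a function of
    its upper limit. Chebyshev's inequality thereby reduces to a pointwise comparison of
    integrands.\<close>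
  define D where "D = (\<lambda>t. (real (2 * M) * t ^ (2 * M - 1) * E t +
    t ^ (2 * M) * (2 * t\<^sup>2 / sqrt (1 + t\<^sup>2))) / (2 * real N))"
  have "((\<lambda>t. t ^ (2 * M) * E t / (2 * real N)) has_real_derivative D t) (at t)" for t
    unfolding D_def by (intro DERIV_cdivide) (auto intro!: derivative_eq_intros E' simp: field_simps)
  then have "(D has_integral (Y ^ (2 * M) * E Y / (2 * real N) - 0 ^ (2 * M) * E 0 / (2 * real N))) {0..Y}"
    using assms(1)
    by (intro fundamental_theorem_of_calculus)
       (auto simp flip: has_real_derivative_iff_has_vector_derivative intro: has_field_derivative_at_within)
  then have "(D has_integral (Y ^ (2 * M) * E Y / (2 * real N))) {0..Y}"
    by (simp add: E_def)
  then have "Y ^ (2 * M) * E Y / (2 * real N) \<le> I"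
  proof (rule has_integral_le[OF _ I])
    fix t assume "t \<in> {0..Y}"
    then have t: "0 \<le> t" by simp
    have "real (2 * M) * t ^ (2 * M - 1) * E t \<le> real (2 * M) * t ^ (2 * M - 1) * (t ^ 3 / sqrt (1 + t\<^sup>2))"
      using t E_le by (intro mult_left_mono) auto
    \<comment> \<open>For M = 0 the truncated exponent \<open>2 * M - 1\<close> is harmless, since
      the factor \<open>real (2 * M)\<close> is 0. The other summand contributes the missing 2 in 2M
      + 2 = 2N.\<close>
    also have "\<dots> = real (2 * M) * (t ^ (2 * N) / sqrt (1 + t\<^sup>2))"
      by (cases M) (simp_all add: N power_add[symmetric] eval_nat_numeral)
    finally have "real (2 * M) * t ^ (2 * M - 1) * E t + t ^ (2 * M) * (2 * t\<^sup>2 / sqrt (1 + t\<^sup>2)) \<le>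
        2 * real N * (t ^ (2 * N) / sqrt (1 + t\<^sup>2))"
      by (simp add: N algebra_simps power2_eq_square add_divide_distrib)
    then show "D t \<le> t ^ (2 * N) / sqrt (1 + t\<^sup>2)"
      unfolding D_def using assms(2) by (simp add: field_simps)
  qed
  then show ?thesis
    by (simp add: N E_def)
qed

section \<open>Two-sided bounds for the remainder\<close>

lemma neg_elliptic_remainder_bounds:
  assumes "0 < l" "l < 1" "0 \<le> k" "k < 1" and N: "N \<ge> 1"
  defines "c \<equiv> 1 - k\<^sup>2"
  defines "Y \<equiv> sqrt ((1 - l\<^sup>2) / c)"
  shows "- elliptic_remainder N l k \<le> (1 - l\<^sup>2) ^ N / (2 * l\<^sup>2 * real N) * (Y / sqrt (1 + Y\<^sup>2))"
    and "inv_sqrt_coeff N * (1 - l\<^sup>2) ^ N / (2 * real N * Y\<^sup>2) * (Y * sqrt (1 + Y\<^sup>2) - arsinh Y) \<le>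
      - elliptic_remainder N l k"
proof -
  have c: "0 < c" "c \<le> 1" and m: "0 < 1 - l\<^sup>2"
    using assms by (auto simp: c_def abs_square_less_1)
  have Y: "Y > 0" and cY: "c * Y\<^sup>2 = 1 - l\<^sup>2"
    unfolding Y_def using c m by simp_all
  define T where "T = (\<lambda>y. 1 / sqrt ((1 - c * y\<^sup>2) * (1 - 1 / (1 + y\<^sup>2) * (c * y\<^sup>2))) -
      (\<Sum>n<N. (c * y\<^sup>2) ^ n * legendre_conv n (1 / (1 + y\<^sup>2))))"
  have T: "((\<lambda>y. T y / sqrt (1 + y\<^sup>2)) has_integral - elliptic_remainder N l k) {0..Y}"
    using neg_elliptic_remainder_has_integral[OF assms(1-4), of N]
    by (simp only: T_def Y_def c_def)
  have pos: "1 + y\<^sup>2 > 0" for y :: real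
    by (simp add: add_pos_nonneg)
  have T_bounds: "(c * y\<^sup>2) ^ N * inv_sqrt_coeff N \<le> T y" "T y \<le> (c * y\<^sup>2) ^ N / l\<^sup>2"
    if "y \<in> {0..Y}" for y
  proof -
    have w: "c * y\<^sup>2 \<le> 1 - l\<^sup>2" "0 \<le> c * y\<^sup>2" "c * y\<^sup>2 < 1"
      using denominators_pos[OF assms(1,2) c(1)] that c unfolding Y_def by auto
    have p: "0 \<le> 1 / (1 + y\<^sup>2)" "1 / (1 + y\<^sup>2) \<le> 1"
      using pos[of y] by auto
    note bounds = legendre_conv_tail_bounds[OF p w(2,3), of N, folded T_def]
    show "(c * y\<^sup>2) ^ N * inv_sqrt_coeff N \<le> T y"
      using bounds(1) by (simp only: T_def)
    have "T y \<le> (c * y\<^sup>2) ^ N / (1 - c * y\<^sup>2)"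
      using bounds(2) by (simp only: T_def)
    \<comment> \<open>Up to \<open>Y\<close> one has w <= 1 - l^2, so 1 - w >= l^2.\<close>
    also have "\<dots> \<le> (c * y\<^sup>2) ^ N / l\<^sup>2"
      using w assms by (intro divide_left_mono) auto
    finally show "T y \<le> (c * y\<^sup>2) ^ N / l\<^sup>2" .
  qed
  \<comment> \<open>One factor y of y^(2N) is reserved for y/sqrt(1 + y^2), which is bounded by its
    value \<open>q\<close> at \<open>Y\<close>. Integrating the remaining y^(2N-1) gives the factor
    1/(2N).\<close>
  define M where "M = 2 * N - 1"
  have M: "Suc M = 2 * N"
    using N by (simp add: M_def)
  define q where "q = Y / sqrt (1 + Y\<^sup>2)"
  have cYN: "c ^ N * Y ^ (2 * N) = (1 - l\<^sup>2) ^ N"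
    by (simp flip: cY add: power_mult_distrib power_mult)
  have "((\<lambda>y. c ^ N / l\<^sup>2 * q * y ^ M) has_integral
      c ^ N / l\<^sup>2 * q * (Y ^ Suc M / real (Suc M))) {0..Y}"
    using Y by (intro has_integral_mult_right has_integral_power_0) simp
  moreover have "c ^ N / l\<^sup>2 * q * (Y ^ Suc M / real (Suc M)) = (1 - l\<^sup>2) ^ N / (2 * l\<^sup>2 * real N) * q"
    unfolding M by (simp flip: cYN add: mult_ac)
  ultimately have U: "((\<lambda>y. c ^ N / l\<^sup>2 * q * y ^ M) has_integral
      (1 - l\<^sup>2) ^ N / (2 * l\<^sup>2 * real N) * q) {0..Y}"
    by (simp only:)
  have "- elliptic_remainder N l k \<le> (1 - l\<^sup>2) ^ N / (2 * l\<^sup>2 * real N) * q"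
  proof (rule has_integral_le[OF T U])
    fix y assume y: "y \<in> {0..Y}"
    have "y / sqrt (1 + y\<^sup>2) \<le> q"
    proof -
      have "y\<^sup>2 \<le> Y\<^sup>2"
        using y by (intro power_mono) auto
      then have "y\<^sup>2 / (1 + y\<^sup>2) \<le> Y\<^sup>2 / (1 + Y\<^sup>2)"
        using pos[of y] pos[of Y] by (simp add: divide_simps algebra_simps)
      then have "sqrt (y\<^sup>2 / (1 + y\<^sup>2)) \<le> sqrt (Y\<^sup>2 / (1 + Y\<^sup>2))"
        by (rule real_sqrt_le_mono)
      then show ?thesis
        using y Y by (simp add: q_def real_sqrt_divide)
    qed
    have "T y / sqrt (1 + y\<^sup>2) \<le> (c * y\<^sup>2) ^ N / l\<^sup>2 / sqrt (1 + y\<^sup>2)"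
      using T_bounds(2)[OF y] pos[of y] by (intro divide_right_mono) auto
    also have "(c * y\<^sup>2) ^ N = c ^ N * (y ^ M * y)"
      by (simp flip: M power_Suc2 add: power_mult_distrib power_mult[symmetric] del: power_Suc)
    also have "c ^ N * (y ^ M * y) / l\<^sup>2 / sqrt (1 + y\<^sup>2) = c ^ N / l\<^sup>2 * y ^ M * (y / sqrt (1 + y\<^sup>2))"
      by simp
    also have "\<dots> \<le> c ^ N / l\<^sup>2 * y ^ M * q"
      using c y \<open>y / sqrt (1 + y\<^sup>2) \<le> q\<close> by (intro mult_left_mono) auto
    finally show "T y / sqrt (1 + y\<^sup>2) \<le> c ^ N / l\<^sup>2 * q * y ^ M"
      by (simp add: mult_ac)
  qed
  then show "- elliptic_remainder N l k \<le>
      (1 - l\<^sup>2) ^ N / (2 * l\<^sup>2 * real N) * (Y / sqrt (1 + Y\<^sup>2))"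
    by (simp only: q_def)
  define I where "I = integral {0..Y} (\<lambda>y. y ^ (2 * N) / sqrt (1 + y\<^sup>2))"
  have "continuous_on {0..Y} (\<lambda>y. y ^ (2 * N) / sqrt (1 + y\<^sup>2))"
    by (intro continuous_intros) (use pos in \<open>simp add: less_imp_neq[symmetric]\<close>)
  then have I: "((\<lambda>y. y ^ (2 * N) / sqrt (1 + y\<^sup>2)) has_integral I) {0..Y}"
    unfolding I_def by (intro integrable_integral integrable_continuous_interval)
  have lo: "c ^ N * inv_sqrt_coeff N * I \<le> - elliptic_remainder N l k"
  proof (rule has_integral_le[OF has_integral_mult_right[OF I] T])
    fix y assume y: "y \<in> {0..Y}"
    have "(c * y\<^sup>2) ^ N * inv_sqrt_coeff N / sqrt (1 + y\<^sup>2) \<le> T y / sqrt (1 + y\<^sup>2)"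
      using T_bounds(1)[OF y] pos[of y] by (intro divide_right_mono) auto
    then show "c ^ N * inv_sqrt_coeff N * (y ^ (2 * N) / sqrt (1 + y\<^sup>2)) \<le> T y / sqrt (1 + y\<^sup>2)"
      by (simp add: power_mult_distrib mult_ac flip: power_mult)
  qed
  have I_ge: "c ^ N * inv_sqrt_coeff N *
      (Y ^ (2 * N - 2) / (2 * real N) * (Y * sqrt (1 + Y\<^sup>2) - arsinh Y)) \<le> c ^ N * inv_sqrt_coeff N * I"
    using integral_even_power_div_sqrt_ge[OF _ N I] Y c inv_sqrt_coeff_pos[of N]
    by (intro mult_left_mono) auto
  have eq: "c ^ N * Y ^ (2 * N - 2) = (1 - l\<^sup>2) ^ N / Y\<^sup>2"
  proof -
    have "Y ^ (2 * N) = Y ^ (2 * N - 2) * Y\<^sup>2"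
      using N by (cases N) (simp_all add: power2_eq_square)
    then show ?thesis
      using Y by (simp flip: cYN)
  qed
  have "c ^ N * inv_sqrt_coeff N *
      (Y ^ (2 * N - 2) / (2 * real N) * (Y * sqrt (1 + Y\<^sup>2) - arsinh Y)) =
      inv_sqrt_coeff N * (c ^ N * Y ^ (2 * N - 2)) / (2 * real N) * (Y * sqrt (1 + Y\<^sup>2) - arsinh Y)"
    by (simp only: times_divide_eq_right times_divide_eq_left mult_ac)
  also have "\<dots> =
      inv_sqrt_coeff N * (1 - l\<^sup>2) ^ N / (2 * real N * Y\<^sup>2) * (Y * sqrt (1 + Y\<^sup>2) - arsinh Y)"
    unfolding eq by (simp add: mult_ac)
  finally have "c ^ N * inv_sqrt_coeff N *
      (Y ^ (2 * N - 2) / (2 * real N) * (Y * sqrt (1 + Y\<^sup>2) - arsinh Y)) =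
      inv_sqrt_coeff N * (1 - l\<^sup>2) ^ N / (2 * real N * Y\<^sup>2) * (Y * sqrt (1 + Y\<^sup>2) - arsinh Y)" .
  then show "inv_sqrt_coeff N * (1 - l\<^sup>2) ^ N / (2 * real N * Y\<^sup>2) *
      (Y * sqrt (1 + Y\<^sup>2) - arsinh Y) \<le> - elliptic_remainder N l k"
    using lo I_ge by linarith
qed

section \<open>Translation of the bounds into l and k\<close>

theorem theorem4:
  fixes l k :: real and N :: nat
  assumes "0 < l" and "l < 1" and "0 < k" and "k < 1" and "N \<ge> 1"
  shows "(ellipticF l k =
           ellipticK k - (1 - l\<^sup>2) powr (1/2) / (1 - k\<^sup>2) powr (1/2) *
             (\<Sum>n<N. (1 - l\<^sup>2) ^ n * elliptic_A n ((1 - l\<^sup>2) / (1 - k\<^sup>2)))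
           + elliptic_remainder N l k)
    \<and> elliptic_remainder N l k < 0
    \<and> (1 - l\<^sup>2) powr (real N + 1/2) / (2 * l\<^sup>2 * real N * sqrt (2 - l\<^sup>2 - k\<^sup>2))
           \<ge> - elliptic_remainder N l k
    \<and> - elliptic_remainder N l k \<ge>
           (1 - l\<^sup>2) powr (real N - 1/2) * pochhammer (1/2) N / (2 * real N * fact N) *
           (sqrt (2 - l\<^sup>2 - k\<^sup>2)
            - (1 - k\<^sup>2) / (2 * sqrt (1 - l\<^sup>2)) *
              ln (1 + 2 * ((1 - l\<^sup>2) / (1 - k\<^sup>2))
                  + 2 * (sqrt ((1 - l\<^sup>2) * (2 - l\<^sup>2 - k\<^sup>2)) / (1 - k\<^sup>2))))"
proof -
  define m c where "m = 1 - l\<^sup>2" and "c = 1 - k\<^sup>2"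
  define Y where "Y = sqrt (m / c)"
  have m: "0 < m" and c: "0 < c"
    using assms by (auto simp: m_def c_def abs_square_less_1)
  have mc: "2 - l\<^sup>2 - k\<^sup>2 = m + c"
    by (simp add: m_def c_def)
  have Y: "Y > 0" and Y2: "Y\<^sup>2 = m / c"
    using m c by (simp_all add: Y_def)
  have sY: "sqrt (1 + Y\<^sup>2) = sqrt (m + c) / sqrt c"
    using c by (simp add: Y2 field_simps flip: real_sqrt_divide)
  note bounds = neg_elliptic_remainder_bounds[OF assms(1,2) less_imp_le[OF assms(3)] assms(4,5),
    folded m_def c_def, folded Y_def]
  \<comment> \<open>The lower bound for the negated remainder is itself strictly positive, by
    \<open>arsinh_less\<close>.\<close>
  have neg: "elliptic_remainder N l k < 0"
  proof -
    have "0 < inv_sqrt_coeff N * m ^ N / (2 * real N * Y\<^sup>2) * (Y * sqrt (1 + Y\<^sup>2) - arsinh Y)"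
      using arsinh_less[OF Y] m Y inv_sqrt_coeff_pos[of N] \<open>N \<ge> 1\<close> by simp
    then show ?thesis using bounds(2) by linarith
  qed
  have upper: "m ^ N / (2 * l\<^sup>2 * real N) * (Y / sqrt (1 + Y\<^sup>2)) =
      m powr (real N + 1/2) / (2 * l\<^sup>2 * real N * sqrt (m + c))"
  proof -
    have "Y / sqrt (1 + Y\<^sup>2) = sqrt m / sqrt (m + c)"
      using c unfolding sY by (simp add: Y_def real_sqrt_divide)
    then show ?thesis
      using m by (simp add: powr_add powr_realpow powr_half_sqrt)
  qed
  have lower: "inv_sqrt_coeff N * m ^ N / (2 * real N * Y\<^sup>2) * (Y * sqrt (1 + Y\<^sup>2) - arsinh Y) =
      m powr (real N - 1/2) * pochhammer (1/2) N / (2 * real N * fact N) *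
      (sqrt (m + c) - c / (2 * sqrt m) * ln (1 + 2 * (m / c) + 2 * (sqrt (m * (m + c)) / c)))"
  proof -
    have YS: "Y * sqrt (1 + Y\<^sup>2) = sqrt m * sqrt (m + c) / c"
      using c unfolding sY by (simp add: Y_def real_sqrt_divide)
    \<comment> \<open>The argument of the logarithm is the square of exp(arsinh Y), which accounts
      for the 1/2 in front of the logarithm.\<close>
    have "1 + 2 * (m / c) + 2 * (sqrt (m * (m + c)) / c) = (Y + sqrt (Y\<^sup>2 + 1))\<^sup>2"
    proof -
      have "(Y + sqrt (1 + Y\<^sup>2))\<^sup>2 = Y\<^sup>2 + (1 + Y\<^sup>2) + 2 * (Y * sqrt (1 + Y\<^sup>2))"
        by (simp add: power2_sum)
      then show ?thesis
        unfolding YS by (simp add: Y2 real_sqrt_mult add.commute)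
    qed
    then have "ln (1 + 2 * (m / c) + 2 * (sqrt (m * (m + c)) / c)) = 2 * arsinh Y"
      using arsinh_real_aux[of Y] by (simp add: arsinh_real_def ln_realpow)
    \<comment> \<open>Dividing by Y^2 = m/c leaves a factor 1/sqrt(m), which lowers the exponent
      from N to N - 1/2.\<close>
    moreover have "(Y * sqrt (1 + Y\<^sup>2) - arsinh Y) / Y\<^sup>2 =
        (sqrt (m + c) - c / sqrt m * arsinh Y) / sqrt m"
    proof -
      have "m = sqrt m * sqrt m" using m by simp
      then show ?thesis
        unfolding YS unfolding Y2 using m c by (simp add: field_simps)
    qed
    moreover have "m powr (real N - 1/2) = m ^ N / sqrt m"
      using m by (simp add: powr_diff powr_realpow powr_half_sqrt)
    moreover have "inv_sqrt_coeff N * m ^ N / (2 * real N * Y\<^sup>2) * (Y * sqrt (1 + Y\<^sup>2) - arsinh Y) =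
        inv_sqrt_coeff N * m ^ N / (2 * real N) * ((Y * sqrt (1 + Y\<^sup>2) - arsinh Y) / Y\<^sup>2)"
      by simp
    ultimately show ?thesis
      by (simp add: inv_sqrt_coeff_def mult_ac)
  qed
  have "ellipticF l k = ellipticK k - (1 - l\<^sup>2) powr (1/2) / (1 - k\<^sup>2) powr (1/2) *
      (\<Sum>n<N. (1 - l\<^sup>2) ^ n * elliptic_A n ((1 - l\<^sup>2) / (1 - k\<^sup>2))) + elliptic_remainder N l k"
    by (simp add: elliptic_remainder_def)
  then show ?thesis
    using neg bounds unfolding upper lower mc m_def[symmetric] c_def[symmetric] by blast
qed

end
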